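(* Irreducible seminormal representations of the Weyl group $WG_2$ with respect to the chain $S_1\subseteq S_2\subseteq WG_2$, where for each label $\phi\in\{\phi_{1,0},\phi_{1,6},\phi_{1,3}',\phi_{1,3}'',\phi_{2,1},\phi_{2,2}\}$ the representation denoted $\phi$ is the irreducible representation with that label, can be given by $$\phi_{1,0}(s_1)=(1),\quad \phi_{1,6}(s_1)=(-1),\quad \phi_{1,3}'(s_1)=(1),\quad \phi_{1,3}''(s_1)=(-1),$$ $$\phi_{1,0}(s_2)=(1),\quad \phi_{1,6}(s_2)=(-1),\quad \phi_{1,3}'(s_2)=(-1),\quad \phi_{1,3}''(s_2)=(1),$$ $$\phi_{2,1}(s_1)=\begin{pmatrix}1&0\\0&-1\end{pmatrix},\quad \phi_{2,1}(s_2)=\begin{pmatrix}\frac12&\frac12\\ \frac32&-\frac12\end{pmatrix},\qquad \phi_{2,2}(s_1)=\begin{pmatrix}1&0\\0&-1\end{pmatrix},\quad \phi_{2,2}(s_2)=\begin{pmatrix}-\frac12&\frac32\\ \frac12&\frac12\end{pmatrix}.$$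
   Context: $WG_2$ is the dihedral group of order $12$, generated by $s_1,s_2$ with relations $s_1s_2s_1s_2s_1s_2=s_2s_1s_2s_1s_2s_1$, $s_1^2=s_2^2=1$; $S_2=\langle s_1\rangle$ and $S_1=\{1\}$. The irreducible characters of $WG_2$ are labeled as follows, by their values on $(1,\ s_1,\ s_2,\ s_1s_2,\ (s_1s_2)^2,\ (s_1s_2)^3)$: $\phi_{1,0}:(1,1,1,1,1,1)$; $\phi_{1,6}:(1,-1,-1,1,1,1)$; $\phi_{1,3}':(1,1,-1,-1,1,-1)$; $\phi_{1,3}'':(1,-1,1,-1,1,-1)$; $\phi_{2,1}:(2,0,0,1,-1,-2)$; $\phi_{2,2}:(2,0,0,-1,-1,2)$. A basis of an irreducible module $V$ of the last group of a chain $G_0\subseteq\cdots\subseteq G_n$ is seminormal if it can be partitioned into subsets whose spans are irreducible $G_{n-1}$-submodules (so that $V$ is their direct sum), each of these subsets can in turn be partitioned so as to realize the decomposition into irreducibles upon restriction to $G_{n-2}$, and so on down the chain. A seminormal representation is the matrix representation with respect to a seminormal basis. *)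

theory Defs
  imports "HOL-Algebra.Generated_Groups" "HOL-Analysis.Analysis" "HOL-Library.Disjoint_Sets"
begin

text \<open>
  The dihedral group of order 12 with its Coxeter generators. The presented group has order 12,
  so a group of that order which is generated by elements satisfying the relations is a copy of it.
\<close>

locale WG2 = group G for G (structure) +
  fixes s1 s2
  assumes generators_closed: "s1 \<in> carrier G" "s2 \<in> carrier G"
    and generated: "generate G {s1, s2} = carrier G"
    and order_12: "card (carrier G) = 12"
    and braid: "s1 \<otimes> s2 \<otimes> s1 \<otimes> s2 \<otimes> s1 \<otimes> s2 = s2 \<otimes> s1 \<otimes> s2 \<otimes> s1 \<otimes> s2 \<otimes> s1"
    and involutions: "s1 \<otimes> s1 = \<one>" "s2 \<otimes> s2 = \<one>"

text \<open>
  Modules are complex and of finite dimension \<open>n\<close>, realised on the vector space \<open>\<complex>\<^sup>n\<close>.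
\<close>

definition linear_action ::
    "('g, 'm) monoid_scheme \<Rightarrow> ('g \<Rightarrow> complex ^ 'n \<Rightarrow> complex ^ 'n) \<Rightarrow> bool" where
  "linear_action G act \<longleftrightarrow>
     (\<forall>g\<in>carrier G. Vector_Spaces.linear (*s) (*s) (act g)) \<and>
     act \<one>\<^bsub>G\<^esub> = id \<and>
     (\<forall>g\<in>carrier G. \<forall>h\<in>carrier G. act (g \<otimes>\<^bsub>G\<^esub> h) = act g \<circ> act h)"

definition stable_subspace ::
    "('g \<Rightarrow> complex ^ 'n \<Rightarrow> complex ^ 'n) \<Rightarrow> 'g set \<Rightarrow> (complex ^ 'n) set \<Rightarrow> bool" where
  "stable_subspace act H W \<longleftrightarrow> vec.subspace W \<and> (\<forall>h\<in>H. act h ` W \<subseteq> W)"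

definition irreducible_submodule ::
    "('g \<Rightarrow> complex ^ 'n \<Rightarrow> complex ^ 'n) \<Rightarrow> 'g set \<Rightarrow> (complex ^ 'n) set \<Rightarrow> bool" where
  "irreducible_submodule act H W \<longleftrightarrow>
     stable_subspace act H W \<and> W \<noteq> {0} \<and>
     (\<forall>U. U \<subseteq> W \<longrightarrow> stable_subspace act H U \<longrightarrow> U = {0} \<or> U = W)"

definition irreducible_module ::
    "('g, 'm) monoid_scheme \<Rightarrow> ('g \<Rightarrow> complex ^ 'n \<Rightarrow> complex ^ 'n) \<Rightarrow> bool" where
  "irreducible_module G act \<longleftrightarrow> linear_action G act \<and> irreducible_submodule act (carrier G) UNIV"

definition character_of :: "('g \<Rightarrow> complex ^ 'n \<Rightarrow> complex ^ 'n) \<Rightarrow> 'g \<Rightarrow> complex" where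
  "character_of act g = trace (matrix (act g))"

definition subgroup_chain :: "('g, 'm) monoid_scheme \<Rightarrow> 'g set list \<Rightarrow> bool" where
  "subgroup_chain G Gs \<longleftrightarrow>
     Gs \<noteq> [] \<and> last Gs = carrier G \<and> (\<forall>H\<in>set Gs. subgroup H G) \<and> sorted_wrt (\<subseteq>) Gs"

text \<open>The chain is listed here from the largest group down.\<close>

primrec adapted ::
    "('g \<Rightarrow> complex ^ 'n \<Rightarrow> complex ^ 'n) \<Rightarrow> 'g set list \<Rightarrow> (complex ^ 'n) set \<Rightarrow> bool" where
  "adapted act [] B \<longleftrightarrow> True"
| "adapted act (H # Hs) B \<longleftrightarrow>
     irreducible_submodule act H (vec.span B) \<and>
     (\<exists>P. partition_on B P \<and> (\<forall>C\<in>P. adapted act Hs C))"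

text \<open>
  A chain \<open>G\<^sub>0 \<subseteq> \<dots> \<subseteq> G\<^sub>n\<close> is the list \<open>[G\<^sub>0, \<dots>, G\<^sub>n]\<close>. Since the basis is independent, the spans of the
  blocks of each partition automatically form a direct sum.
\<close>

definition seminormal_basis ::
    "('g, 'm) monoid_scheme \<Rightarrow> 'g set list \<Rightarrow> ('g \<Rightarrow> complex ^ 'n \<Rightarrow> complex ^ 'n) \<Rightarrow>
     ('n \<Rightarrow> complex ^ 'n) \<Rightarrow> bool" where
  "seminormal_basis G Gs act b \<longleftrightarrow>
     subgroup_chain G Gs \<and> irreducible_module G act \<and>
     inj b \<and> vec.independent (range b) \<and> vec.span (range b) = UNIV \<and>
     adapted act (rev Gs) (range b)"

text \<open>Column \<open>j\<close> holds the coordinates of the image of the \<open>j\<close>-th basis vector.\<close>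

definition matrix_wrt ::
    "('n \<Rightarrow> complex ^ 'n) \<Rightarrow> (complex ^ 'n \<Rightarrow> complex ^ 'n) \<Rightarrow> complex ^ 'n ^ 'n" where
  "matrix_wrt b f = (\<chi> i j. vec.representation (range b) (f (b j)) (b i))"

text \<open>Single and double primes are rendered by the suffixes \<open>p\<close> and \<open>pp\<close>.\<close>

datatype label = phi_1_0 | phi_1_6 | phi_1_3p | phi_1_3pp | phi_2_1 | phi_2_2

text \<open>
  Values on \<open>1\<close>, \<open>s\<^sub>1\<close>, \<open>s\<^sub>2\<close>, \<open>s\<^sub>1s\<^sub>2\<close>, \<open>(s\<^sub>1s\<^sub>2)\<^sup>2\<close>, \<open>(s\<^sub>1s\<^sub>2)\<^sup>3\<close>, which represent the six conjugacy classes.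
\<close>

primrec char_values :: "label \<Rightarrow> complex list" where
  "char_values phi_1_0   = [1,  1,  1,  1,  1,  1]"
| "char_values phi_1_6   = [1, -1, -1,  1,  1,  1]"
| "char_values phi_1_3p  = [1,  1, -1, -1,  1, -1]"
| "char_values phi_1_3pp = [1, -1,  1, -1,  1, -1]"
| "char_values phi_2_1   = [2,  0,  0,  1, -1, -2]"
| "char_values phi_2_2   = [2,  0,  0, -1, -1,  2]"

definition irreducible_with_label ::
    "('g, 'm) monoid_scheme \<Rightarrow> 'g \<Rightarrow> 'g \<Rightarrow> label \<Rightarrow> ('g \<Rightarrow> complex ^ 'n \<Rightarrow> complex ^ 'n) \<Rightarrow> bool" where
  "irreducible_with_label G s1 s2 \<phi> act \<longleftrightarrow>
     irreducible_module G act \<and>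
     map (character_of act)
       [\<one>\<^bsub>G\<^esub>, s1, s2, s1 \<otimes>\<^bsub>G\<^esub> s2, (s1 \<otimes>\<^bsub>G\<^esub> s2) [^]\<^bsub>G\<^esub> (2::nat), (s1 \<otimes>\<^bsub>G\<^esub> s2) [^]\<^bsub>G\<^esub> (3::nat)]
     = char_values \<phi>"

definition WG2_chain :: "('g, 'm) monoid_scheme \<Rightarrow> 'g \<Rightarrow> 'g set list" where
  "WG2_chain G s1 = [{\<one>\<^bsub>G\<^esub>}, generate G {s1}, carrier G]"

text \<open>
  ``The irreducible representation with label \<open>\<phi>\<close>'' is only determined up to isomorphism. So we ask
  that one exists and that, on each of its realisations, a seminormal basis can be chosen such that
  the generators have the prescribed matrices.
\<close>

definition seminormal_form ::
    "('g, 'm) monoid_scheme \<Rightarrow> 'g \<Rightarrow> 'g \<Rightarrow> label \<Rightarrow> complex ^ 'n ^ 'n \<Rightarrow> complex ^ 'n ^ 'n \<Rightarrow> bool" where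
  "seminormal_form G s1 s2 \<phi> A1 A2 \<longleftrightarrow>
     (\<exists>act :: 'g \<Rightarrow> complex ^ 'n \<Rightarrow> complex ^ 'n. irreducible_with_label G s1 s2 \<phi> act) \<and>
     (\<forall>act :: 'g \<Rightarrow> complex ^ 'n \<Rightarrow> complex ^ 'n. irreducible_with_label G s1 s2 \<phi> act \<longrightarrow>
        (\<exists>b. seminormal_basis G (WG2_chain G s1) act b \<and>
             matrix_wrt b (act s1) = A1 \<and> matrix_wrt b (act s2) = A2))"

end

theory Submission imports Defs begin

text \<open>
  The relations leave only twelve alternating words in the generators, so a group of order 12 has
  the universal property of the presentation, and matrices satisfying the relations define a module.
  Conversely, in a two-dimensional module with the given character the trace forces \<open>s\<^sub>1\<close> to have
  the eigenvalues \<open>1\<close> and \<open>-1\<close>, and a basis of eigenvectors is seminormal. In it the traces of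
  \<open>s\<^sub>2\<close> and \<open>s\<^sub>1s\<^sub>2\<close> determine the diagonal of the matrix of \<open>s\<^sub>2\<close>, \<open>s\<^sub>2\<^sup>2 = 1\<close> determines the product
  of the off-diagonal entries, and rescaling one eigenvector adjusts these to the prescribed values.
\<close>

section \<open>Normal forms and the universal property of the presentation\<close>

text \<open>The alternating words of length at most 6 are closed under left multiplication by each
  letter: an involution cancels a repeated first letter, and the braid relation handles words that
  become too long. No inverses enter, so the lemma applies to a product with a mere monoid. The
  words may coincide, hence only an upper bound on the count.\<close>

lemma (in monoid) dihedral_normal_forms:
  assumes xy: "x \<in> carrier G" "y \<in> carrier G"
    and xx: "x \<otimes> x = \<one>" and yy: "y \<otimes> y = \<one>"
    and braid: "x \<otimes> y \<otimes> x \<otimes> y \<otimes> x \<otimes> y = y \<otimes> x \<otimes> y \<otimes> x \<otimes> y \<otimes> x"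
  obtains N where "N \<subseteq> carrier G" "finite N" "card N \<le> 12" "\<one> \<in> N" "x \<in> N" "y \<in> N"
    "\<And>u v. u \<in> N \<Longrightarrow> v \<in> N \<Longrightarrow> u \<otimes> v \<in> N"
proof -
  have xxz: "x \<otimes> (x \<otimes> z) = z" and yyz: "y \<otimes> (y \<otimes> z) = z" if "z \<in> carrier G" for z
    using that xy xx yy by (simp_all flip: m_assoc)
  have b: "y \<otimes> (x \<otimes> (y \<otimes> (x \<otimes> (y \<otimes> x)))) = x \<otimes> (y \<otimes> (x \<otimes> (y \<otimes> (x \<otimes> y))))"
    using braid xy by (simp add: m_assoc)
  \<comment> \<open>Only \<open>y\<close> times the longest word leaves length 6; the braid relation
    turns it into a word ending in \<open>y \<otimes> y\<close>, which cancels.\<close>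
  have "y \<otimes> (x \<otimes> (y \<otimes> (x \<otimes> (y \<otimes> (x \<otimes> y))))) = (x \<otimes> (y \<otimes> (x \<otimes> (y \<otimes> (x \<otimes> y))))) \<otimes> y"
    using xy by (simp flip: b add: m_assoc)
  then have b': "y \<otimes> (x \<otimes> (y \<otimes> (x \<otimes> (y \<otimes> (x \<otimes> y))))) = x \<otimes> (y \<otimes> (x \<otimes> (y \<otimes> x)))"
    using xy by (simp add: m_assoc yy)
  define L where "L = [\<one>, x, y, x \<otimes> y, y \<otimes> x, x \<otimes> (y \<otimes> x), y \<otimes> (x \<otimes> y),
    x \<otimes> (y \<otimes> (x \<otimes> y)), y \<otimes> (x \<otimes> (y \<otimes> x)), x \<otimes> (y \<otimes> (x \<otimes> (y \<otimes> x))),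
    y \<otimes> (x \<otimes> (y \<otimes> (x \<otimes> y))), x \<otimes> (y \<otimes> (x \<otimes> (y \<otimes> (x \<otimes> y))))]"
  have L: "set L \<subseteq> carrier G"
    using xy by (simp add: L_def)
  have step: "x \<otimes> v \<in> set L" "y \<otimes> v \<in> set L" if "v \<in> set L" for v
    using that xy unfolding L_def
    by (auto simp: xx yy xxz yyz b b')
  show ?thesis
  proof
    show "card (set L) \<le> 12"
      using card_length[of L] by (simp add: L_def)
    show "u \<otimes> v \<in> set L" if u: "u \<in> set L" and v: "v \<in> set L" for u v
    proof -
      have "v \<in> carrier G" using v L by blast
      then show ?thesis
        \<comment> \<open>Reassociation lets the letters of \<open>u\<close> act on \<open>v\<close>
          one at a time, each covered by \<open>step\<close>.\<close>
        using u[unfolded L_def] v xy by (auto simp: m_assoc intro!: step)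
    qed
  qed (use L in \<open>auto simp: L_def\<close>)
qed

text \<open>
  The normal forms in the product \<open>G \<times> M\<close> map onto \<open>G\<close>; there are at most twelve of them,
  so they are the graph of a homomorphism.
\<close>

lemma (in WG2) extend_generators:
  assumes "monoid M" and xy: "x \<in> carrier M" "y \<in> carrier M"
    and "x \<otimes>\<^bsub>M\<^esub> x = \<one>\<^bsub>M\<^esub>" "y \<otimes>\<^bsub>M\<^esub> y = \<one>\<^bsub>M\<^esub>"
    and "x \<otimes>\<^bsub>M\<^esub> y \<otimes>\<^bsub>M\<^esub> x \<otimes>\<^bsub>M\<^esub> y \<otimes>\<^bsub>M\<^esub> x \<otimes>\<^bsub>M\<^esub> y
      = y \<otimes>\<^bsub>M\<^esub> x \<otimes>\<^bsub>M\<^esub> y \<otimes>\<^bsub>M\<^esub> x \<otimes>\<^bsub>M\<^esub> y \<otimes>\<^bsub>M\<^esub> x"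
  obtains \<rho> where "\<rho> \<in> hom G M" "\<rho> \<one> = \<one>\<^bsub>M\<^esub>" "\<rho> s1 = x" "\<rho> s2 = y"
proof -
  interpret M: monoid M by fact
  interpret P: monoid "G \<times>\<times> M"
    by (rule DirProd_monoid) unfold_locales
  obtain N where N: "N \<subseteq> carrier (G \<times>\<times> M)" "finite N" "card N \<le> 12"
    and one_N: "(\<one>, \<one>\<^bsub>M\<^esub>) \<in> N" and gen_N: "(s1, x) \<in> N" "(s2, y) \<in> N"
    and mult_N: "\<And>u v. u \<in> N \<Longrightarrow> v \<in> N \<Longrightarrow> u \<otimes>\<^bsub>G \<times>\<times> M\<^esub> v \<in> N"
    by (rule P.dihedral_normal_forms[of "(s1, x)" "(s2, y)"])
      (use assms generators_closed involutions braid in auto)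
  have mult_N': "(g \<otimes> h, u \<otimes>\<^bsub>M\<^esub> v) \<in> N" if "(g, u) \<in> N" "(h, v) \<in> N" for g h u v
    using mult_N[OF that] by simp
  \<comment> \<open>\<open>generate\<close> also admits inverses of generators, while
    \<open>N\<close> is closed only under products; for involutions the inverses are the generators
    themselves.\<close>
  have inv_gen: "inv s1 = s1" "inv s2 = s2"
    using generators_closed involutions by (auto intro!: inv_equality)
  have "g \<in> fst ` N" if "g \<in> generate G {s1, s2}" for g
    using that
  proof induction
    case one
    then show ?case using one_N by force
  next
    case (incl h)
    then show ?case using gen_N by force
  next
    case (inv h)
    then show ?case using gen_N inv_gen by force
  next
    case (eng g h)
    then show ?case using mult_N' by force
  qed
  then have fst_N: "fst ` N = carrier G"
    using N generated by auto
  then have "inj_on fst N"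
    using N order_12 card_image_le[of N fst] by (intro eq_card_imp_inj_on) auto
  then have functional: "u = v" if "(g, u) \<in> N" "(g, v) \<in> N" for g u v
    using that inj_onD[of fst N "(g, u)" "(g, v)"] by simp
  define \<rho> where "\<rho> g = (THE u. (g, u) \<in> N)" for g
  have \<rho>_eq: "\<rho> g = u" if "(g, u) \<in> N" for g u
    unfolding \<rho>_def using that functional by blast
  have \<rho>_N: "(g, \<rho> g) \<in> N" if "g \<in> carrier G" for g
  proof -
    have "g \<in> fst ` N"
      using that by (simp only: fst_N)
    then obtain p where "p \<in> N" "g = fst p"
      by (rule imageE)
    then have "(g, snd p) \<in> N" by simp
    with \<rho>_eq[OF this] show ?thesis by (simp only:)
  qed
  show ?thesis
  proof
    show "\<rho> \<in> hom G M"
      using \<rho>_N N by (auto simp: hom_def intro: \<rho>_eq mult_N')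
  qed (use \<rho>_eq one_N gen_N in auto)
qed

text \<open>The target monoid consists of all square matrices, singular ones included; the resulting
  homomorphism is composed with matrix-vector multiplication.\<close>

lemma (in WG2) linear_action_extend_generators:
  fixes A1 A2 :: "complex ^ 'n ^ 'n"
  assumes "A1 ** A1 = mat 1" "A2 ** A2 = mat 1"
    and "A1 ** A2 ** A1 ** A2 ** A1 ** A2 = A2 ** A1 ** A2 ** A1 ** A2 ** A1"
  obtains act where "linear_action G act" "act s1 = (*v) A1" "act s2 = (*v) A2"
proof -
  let ?M = "\<lparr>carrier = UNIV, monoid.mult = (**), one = mat 1\<rparr> :: (complex ^ 'n ^ 'n) monoid"
  have "monoid ?M"
    by unfold_locales (auto simp: matrix_mul_assoc)
  then obtain \<rho> where \<rho>: "\<rho> \<in> hom G ?M" "\<rho> \<one> = mat 1" "\<rho> s1 = A1" "\<rho> s2 = A2"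
    by (rule extend_generators[where x = A1 and y = A2]) (use assms in auto)
  show ?thesis
  proof
    show "linear_action G (\<lambda>g. (*v) (\<rho> g))"
      using \<rho>(1,2) by (auto simp: linear_action_def hom_def matrix_vector_mul_assoc)
  qed (use \<rho> in auto)
qed

section \<open>Coordinates and traces with respect to an indexed basis\<close>

context
  fixes b :: "'n \<Rightarrow> complex ^ 'n"
  assumes indep: "\<forall>c. (\<Sum>i\<in>UNIV. c i *s b i) = 0 \<longrightarrow> (\<forall>i. c i = 0)"
begin

lemma basis_family_inj: "inj b"
proof (rule injI, rule ccontr)
  fix i j assume "b i = b j" "i \<noteq> j"
  let ?c = "\<lambda>k. if k = i then 1 else if k = j then -1 else 0 :: complex"
  have "(\<Sum>k\<in>UNIV. ?c k *s b k) = (\<Sum>k\<in>{i, j}. ?c k *s b k)"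
    by (intro sum.mono_neutral_right) auto
  also have "\<dots> = 0"
    using \<open>b i = b j\<close> \<open>i \<noteq> j\<close> by simp
  finally have "?c i = 0"
    by (rule indep[rule_format, of ?c i])
  then show False by simp
qed

lemma basis_family_independent: "vec.independent (range b)"
proof (rule vec.independent_if_scalars_zero)
  fix f x assume "(\<Sum>x\<in>range b. f x *s x) = 0" "x \<in> range b"
  then show "f x = 0"
    using indep[rule_format, of "f \<circ> b"] by (auto simp: sum.reindex[OF basis_family_inj])
qed simp

text \<open>Injectivity gives the independent family as many members as the dimension.\<close>

lemma basis_family_span: "vec.span (range b) = UNIV"
  using vec.card_ge_dim_independent[OF subset_UNIV basis_family_independent]
  by (auto simp: card_image[OF basis_family_inj] vec.dim_UNIV card_cart_basis)

text \<open>Coordinates are linear and those of a basis vector form a unit vector, so exhibiting the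
  expansions of the images settles the matrix.\<close>

lemma matrix_wrt_basis_family:
  assumes f: "\<And>j. f (b j) = (\<Sum>i\<in>UNIV. M $ i $ j *s b i)"
  shows "matrix_wrt b f = M"
proof -
  have "vec.representation (range b) (f (b j)) (b i) = M $ i $ j" for i j
  proof -
    have "vec.representation (range b) (f (b j))
        = (\<lambda>v. \<Sum>k\<in>UNIV. vec.representation (range b) (M $ k $ j *s b k) v)"
      unfolding f by (intro vec.representation_sum) (auto simp: basis_family_independent basis_family_span)
    then show ?thesis
      by (simp add: vec.representation_scale vec.representation_basis basis_family_independent
          basis_family_span inj_eq[OF basis_family_inj] if_distrib[of "\<lambda>x. _ * x"] cong: if_cong)
  qed
  then show ?thesis
    by (simp add: matrix_wrt_def vec_eq_iff)
qed

text \<open>If \<open>P\<close> has the basis as its columns, then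
  \<open>matrix f ** P = P ** M\<close>. Independence of the columns makes \<open>P\<close>
  invertible, so the two matrices are similar.\<close>

lemma trace_eq_trace_wrt_basis_family:
  assumes lin: "Vector_Spaces.linear (*s) (*s) f"
    and f: "\<And>j. f (b j) = (\<Sum>i\<in>UNIV. M $ i $ j *s b i)"
  shows "trace (matrix f) = trace M"
proof -
  define P where "P = (\<chi> i j. b j $ i)"
  have col: "column j P = b j" for j
    by (simp add: P_def column_def vec_eq_iff)
  have "\<exists>Q. Q ** P = mat 1"
    unfolding matrix_left_invertible_independent_columns using indep by (simp add: col)
  then obtain Q where Q: "Q ** P = mat 1" by blast
  have "column j (matrix f ** P) = column j (P ** M)" for j
  proof -
    have "column j (matrix f ** P) = matrix f *v b j"
      by (simp add: column_def P_def matrix_matrix_mult_def matrix_vector_mult_def vec_eq_iff)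
    also have "\<dots> = f (b j)"
      by (rule matrix_works[OF lin])
    also have "\<dots> = column j (P ** M)"
      by (simp add: f column_def P_def matrix_matrix_mult_def vec_eq_iff mult.commute)
    finally show ?thesis .
  qed
  then have "matrix f ** P = P ** M"
    by (simp add: column_def vec_eq_iff)
  then have "Q ** (matrix f ** P) = M"
    by (simp add: matrix_mul_assoc Q)
  moreover have "P ** Q = mat 1"
    using Q by (simp add: matrix_left_right_inverse)
  ultimately show ?thesis
    by (metis matrix_mul_assoc matrix_mul_rid trace_mul_sym)
qed

end

section \<open>Eigenvectors, adapted bases and the subgroup chain\<close>

text \<open>A common eigenvector makes its line stable, and a line has no subspaces other than zero
  and itself.\<close>

lemma eigenvector_span_irreducible:
  assumes v: "v \<noteq> 0"
    and lin: "\<And>h. h \<in> H \<Longrightarrow> Vector_Spaces.linear (*s) (*s) (act h)"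
    and eig: "\<And>h. h \<in> H \<Longrightarrow> \<exists>c. act h v = c *s v"
  shows "irreducible_submodule act H (vec.span {v})"
proof -
  have "stable_subspace act H (vec.span {v})"
    unfolding stable_subspace_def
  proof (intro conjI ballI)
    fix h assume h: "h \<in> H"
    then obtain c where c: "act h v = c *s v" using eig by blast
    have "act h (k *s v) \<in> vec.span {v}" for k
      using lin[OF h] c by (simp add: vec.linear_scale vec.span_scale vec.span_base)
    then show "act h ` vec.span {v} \<subseteq> vec.span {v}"
      by (auto simp: vec.span_singleton)
  qed simp
  moreover have "vec.span {v} \<noteq> {0}"
    using v vec.span_base[of v "{v}"] by auto
  moreover have "U = {0} \<or> U = vec.span {v}"
    if "U \<subseteq> vec.span {v}" "vec.subspace U" for U
  proof (cases "v \<in> U")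
    case True
    then show ?thesis
      using that vec.span_minimal[of "{v}" U] by auto
  next
    case False
    have "u = 0" if u: "u \<in> U" for u
    proof -
      obtain k where k: "u = k *s v"
        using u \<open>U \<subseteq> _\<close> by (auto simp: vec.span_singleton)
      have "k = 0"
        using vec.subspace_scale[OF \<open>vec.subspace U\<close> u, of "inverse k"] False
        by (cases "k = 0") (auto simp: k)
      then show ?thesis by (simp add: k)
    qed
    then show ?thesis
      using vec.subspace_0[OF \<open>vec.subspace U\<close>] by auto
  qed
  ultimately show ?thesis
    by (simp add: irreducible_submodule_def stable_subspace_def)
qed

text \<open>A singleton is partitioned by itself as the only block, so every level of the chain
  poses the same question about the line of \<open>v\<close>.\<close>

lemma adapted_eigenvector:
  assumes "v \<noteq> 0"
    and "\<And>H h. H \<in> set Hs \<Longrightarrow> h \<in> H \<Longrightarrow> Vector_Spaces.linear (*s) (*s) (act h) \<and> (\<exists>c. act h v = c *s v)"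
  shows "adapted act Hs {v}"
  using assms(2)
proof (induction Hs)
  case (Cons H Hs)
  have "partition_on {v} {{v}}"
    by (simp add: partition_on_def)
  moreover have "adapted act Hs {v}"
    by (rule Cons.IH, rule Cons.prems) auto
  ultimately have "\<exists>P. partition_on {v} P \<and> (\<forall>C\<in>P. adapted act Hs C)"
    by (intro exI[of _ "{{v}}"]) simp
  moreover have "irreducible_submodule act H (vec.span {v})"
    using Cons.prems[of H] by (intro eigenvector_span_irreducible assms(1)) auto
  ultimately show ?case by simp
qed simp


lemma linear_complex_1_eq_scale_trace:
  fixes f :: "complex ^ 1 \<Rightarrow> complex ^ 1"
  assumes "Vector_Spaces.linear (*s) (*s) f"
  shows "f v = trace (matrix f) *s v"
proof -
  have "f v = matrix f *v v"
    by (simp add: matrix_works[OF assms])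
  then show ?thesis
    by (simp add: vec_eq_iff matrix_vector_mult_def trace_def)
qed

lemma (in WG2) WG2_chain_subgroup_chain: "subgroup_chain G (WG2_chain G s1)"
proof -
  have "generate G {s1} \<subseteq> carrier G"
    using generators_closed by (intro generate_incl) auto
  moreover have "subgroup (generate G {s1}) G"
    using generators_closed by (intro generate_is_subgroup) auto
  ultimately show ?thesis
    using triv_subgroup subgroup_self
    by (auto simp: subgroup_chain_def WG2_chain_def intro: generate.one)
qed

lemma (in WG2) generate_s1: "generate G {s1} = {\<one>, s1}"
proof
  have inv_s1: "inv s1 = s1"
    using generators_closed involutions by (auto intro!: inv_equality)
  have "g \<in> {\<one>, s1}" if "g \<in> generate G {s1}" for g
    using that
  proof induction
    case (eng g h)
    then show ?case using generators_closed involutions by auto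
  qed (auto simp: inv_s1)
  then show "generate G {s1} \<subseteq> {\<one>, s1}" by blast
qed (auto intro: generate.intros)

section \<open>One-dimensional representations\<close>

text \<open>Treats the four sign choices together. In dimension one each group element acts as the
  scalar given by its character, so any nonzero vector is a seminormal basis.\<close>

lemma (in WG2) seminormal_form_dim_1:
  fixes e1 e2 :: complex
  assumes chars: "char_values \<phi> = [1, e1, e2, e1 * e2, 1, e1 * e2]"
    and e: "e1\<^sup>2 = 1" "e2\<^sup>2 = 1"
  shows "seminormal_form G s1 s2 \<phi> (vector [vector [e1]] :: complex ^ 1 ^ 1) (vector [vector [e2]])"
  unfolding seminormal_form_def
proof (intro conjI allI impI)
  let ?A1 = "vector [vector [e1]] :: complex ^ 1 ^ 1"
  let ?A2 = "vector [vector [e2]] :: complex ^ 1 ^ 1"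
  have e1212: "e1 * e2 * (e1 * e2) = 1"
    using e by (metis mult_1 power2_eq_square power_mult_distrib)
  have irr: "irreducible_submodule act (carrier G) UNIV"
    if lin: "\<And>g. g \<in> carrier G \<Longrightarrow> Vector_Spaces.linear (*s) (*s) (act g)"
    for act :: "'a \<Rightarrow> complex ^ 1 \<Rightarrow> complex ^ 1"
  proof -
    have "u \<in> vec.span {axis 1 1}" for u :: "complex ^ 1"
    proof -
      have "u = (u $ 1) *s axis 1 1" by (simp add: vec_eq_iff)
      then show ?thesis by (metis vec.span_base vec.span_scale singletonI)
    qed
    then have "vec.span {axis 1 1 :: complex ^ 1} = UNIV" by blast
    then show ?thesis
      using eigenvector_span_irreducible[of "axis 1 1 :: complex ^ 1" "carrier G" act]
        lin linear_complex_1_eq_scale_trace by (metis axis_eq_0_iff zero_neq_one)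
  qed
  show "\<exists>act :: 'a \<Rightarrow> complex ^ 1 \<Rightarrow> complex ^ 1. irreducible_with_label G s1 s2 \<phi> act"
  proof -
    obtain act where act: "linear_action G act" "act s1 = (*v) ?A1" "act s2 = (*v) ?A2"
      by (rule linear_action_extend_generators[of ?A1 ?A2])
        (use e in \<open>auto simp: vec_eq_iff matrix_matrix_mult_def mat_def power2_eq_square\<close>)
    have "irreducible_module G act"
      using act irr by (auto simp: irreducible_module_def linear_action_def)
    moreover have "map (character_of act) [\<one>, s1, s2, s1 \<otimes> s2, (s1 \<otimes> s2) [^] (2::nat), (s1 \<otimes> s2) [^] (3::nat)]
        = char_values \<phi>"
      using act generators_closed e1212 e
      by (simp add: chars character_of_def linear_action_def numeral_2_eq_2 numeral_3_eq_3 comp_def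
          matrix_vector_mul_assoc trace_def matrix_matrix_mult_def power2_eq_square
          matrix_id_mat_1[unfolded id_def] id_def mat_def)
    ultimately show ?thesis
      unfolding irreducible_with_label_def by blast
  qed
  fix act :: "'a \<Rightarrow> complex ^ 1 \<Rightarrow> complex ^ 1"
  assume "irreducible_with_label G s1 s2 \<phi> act"
  then have act: "irreducible_module G act" "character_of act s1 = e1" "character_of act s2 = e2"
    by (auto simp: irreducible_with_label_def chars)
  then have lin: "Vector_Spaces.linear (*s) (*s) (act g)" if "g \<in> carrier G" for g
    using that by (auto simp: irreducible_module_def linear_action_def)
  have scalar: "act g v = character_of act g *s v" if "g \<in> carrier G" for g v
    using linear_complex_1_eq_scale_trace[OF lin[OF that]] by (simp add: character_of_def)
  \<comment> \<open>The index type has one element, so this constant family is the standard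
    basis.\<close>
  define b :: "1 \<Rightarrow> complex ^ 1" where "b = (\<lambda>i. axis 1 1)"
  have indep: "\<forall>c. (\<Sum>i\<in>UNIV. c i *s b i) = 0 \<longrightarrow> (\<forall>i. c i = 0)"
    by (simp add: b_def vec_eq_iff forall_1)
  have "adapted act (rev (WG2_chain G s1)) {axis 1 1}"
  proof (rule adapted_eigenvector)
    fix H g assume "H \<in> set (rev (WG2_chain G s1))" "g \<in> H"
    then have "g \<in> carrier G"
      using generators_closed by (auto simp: WG2_chain_def generate_s1)
    then show "Vector_Spaces.linear (*s) (*s) (act g) \<and> (\<exists>c. act g (axis 1 1) = c *s axis 1 1)"
      using lin scalar by blast
  qed (simp add: axis_eq_0_iff)
  then have "seminormal_basis G (WG2_chain G s1) act b"
    using act WG2_chain_subgroup_chain basis_family_inj[OF indep] basis_family_independent[OF indep]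
      basis_family_span[OF indep]
    by (simp add: seminormal_basis_def b_def)
  moreover have "\<forall>j. act s1 (b j) = (\<Sum>i\<in>UNIV. ?A1 $ i $ j *s b i)"
    "\<forall>j. act s2 (b j) = (\<Sum>i\<in>UNIV. ?A2 $ i $ j *s b i)"
    by (simp_all add: forall_1 b_def act generators_closed scalar)
  then have "matrix_wrt b (act s1) = ?A1" "matrix_wrt b (act s2) = ?A2"
    using matrix_wrt_basis_family[OF indep] by blast+
  ultimately show "\<exists>b. seminormal_basis G (WG2_chain G s1) act b \<and>
      matrix_wrt b (act s1) = ?A1 \<and> matrix_wrt b (act s2) = ?A2"
    by blast
qed

section \<open>Two-dimensional representations\<close>

text \<open>Treats both labels together: \<open>a\<close> is half the character value at
  \<open>s1 \<otimes> s2\<close>, so \<open>1/2\<close> or \<open>-1/2\<close>. The hypotheses give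
  \<open>a\<^sup>2 + b * c = 1\<close>, which makes the second matrix an involution and gives the
  product of the two matrices determinant 1.\<close>

lemma (in WG2) seminormal_form_dim_2:
  fixes a b c :: complex
  assumes chars: "char_values \<phi> = [2, 0, 0, 2 * a, -1, - 4 * a]"
    and a: "4 * a\<^sup>2 = 1" and bc: "b * c = 3 / 4"
  shows "seminormal_form G s1 s2 \<phi> (vector [vector [1, 0], vector [0, -1]] :: complex ^ 2 ^ 2)
    (vector [vector [a, b], vector [c, - a]])"
  unfolding seminormal_form_def
proof (intro conjI allI impI)
  let ?A1 = "vector [vector [1, 0], vector [0, -1]] :: complex ^ 2 ^ 2"
  let ?A2 = "vector [vector [a, b], vector [c, - a]] :: complex ^ 2 ^ 2"
  have "b \<noteq> 0" "c \<noteq> 0" using bc by auto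
  have aa: "a * a = 1 / 4" using a by (simp add: power2_eq_square field_simps)
  have cb: "c * b = 3 / 4" using bc by (simp add: mult.commute)
  have A12: "?A1 ** ?A2 = vector [vector [a, b], vector [- c, a]]"
    "?A2 ** ?A1 = vector [vector [a, - b], vector [c, a]]"
    by (simp_all add: vec_eq_iff forall_2 matrix_matrix_mult_def sum_2)
  have A12_2: "?A1 ** ?A2 ** (?A1 ** ?A2) = vector [vector [- 1 / 2, 2 * a * b], vector [- 2 * a * c, - 1 / 2]]"
    "?A2 ** ?A1 ** (?A2 ** ?A1) = vector [vector [- 1 / 2, - 2 * a * b], vector [2 * a * c, - 1 / 2]]"
    unfolding A12
    by (simp_all add: vec_eq_iff forall_2 matrix_matrix_mult_def sum_2 aa bc cb)
  have aax: "a * (a * z) = z / 4" for z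
    using aa by (metis mult.assoc mult.left_neutral times_divide_eq_left)
  \<comment> \<open>Both cubes are the same scalar matrix; this is the braid relation.\<close>
  have A12_3: "?A1 ** ?A2 ** (?A1 ** ?A2) ** (?A1 ** ?A2) = vector [vector [- 2 * a, 0], vector [0, - 2 * a]]"
    "?A2 ** ?A1 ** (?A2 ** ?A1) ** (?A2 ** ?A1) = vector [vector [- 2 * a, 0], vector [0, - 2 * a]]"
    unfolding A12_2 unfolding A12
    by (simp_all add: vec_eq_iff forall_2 matrix_matrix_mult_def sum_2 aa bc cb aax mult.assoc)
  show "\<exists>act :: 'a \<Rightarrow> complex ^ 2 \<Rightarrow> complex ^ 2. irreducible_with_label G s1 s2 \<phi> act"
  proof -
    have "?A1 ** ?A1 = mat 1" "?A2 ** ?A2 = mat 1"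
      by (simp_all add: vec_eq_iff forall_2 matrix_matrix_mult_def sum_2 mat_def aa bc cb)
    moreover have "?A1 ** ?A2 ** ?A1 ** ?A2 ** ?A1 ** ?A2 = ?A2 ** ?A1 ** ?A2 ** ?A1 ** ?A2 ** ?A1"
      using A12_3 by (simp add: matrix_mul_assoc)
    ultimately obtain act where act: "linear_action G act" "act s1 = (*v) ?A1" "act s2 = (*v) ?A2"
      by (rule linear_action_extend_generators)
    \<comment> \<open>For nonzero \<open>u\<close> in \<open>U\<close>, the sum and difference of
      \<open>u\<close> and its image under \<open>?A1\<close> isolate its coordinates, so
      \<open>U\<close> contains a standard basis vector. The nonzero off-diagonal entries of
      \<open>?A2\<close> then yield the other one.\<close>
    have "U = {0} \<or> U = UNIV" if U: "stable_subspace act (carrier G) U" for U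
    proof (cases "U = {0}")
      case False
      have sub: "vec.subspace U" using U by (simp add: stable_subspace_def)
      have st: "?A1 *v u \<in> U" "?A2 *v u \<in> U" if "u \<in> U" for u
      proof -
        have "act g u \<in> U" if "g \<in> carrier G" for g
          using U \<open>u \<in> U\<close> that by (auto simp: stable_subspace_def)
        from this[of s1] this[of s2] show "?A1 *v u \<in> U" "?A2 *v u \<in> U"
          using generators_closed act(2,3) by simp_all
      qed
      let ?e1 = "vector [1, 0] :: complex ^ 2" and ?e2 = "vector [0, 1] :: complex ^ 2"
      obtain u where u: "u \<in> U" "u \<noteq> 0"
        using False vec.subspace_0[OF sub] by blast
      have u1: "(2 * u $ 1) *s ?e1 \<in> U"
      proof -
        have "(2 * u $ 1) *s ?e1 = u + ?A1 *v u"
          by (simp add: vec_eq_iff forall_2 matrix_vector_mult_def sum_2)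
        then show ?thesis using u(1) st sub by (simp add: vec.subspace_add)
      qed
      have u2: "(2 * u $ 2) *s ?e2 \<in> U"
      proof -
        have "(2 * u $ 2) *s ?e2 = u - ?A1 *v u"
          by (simp add: vec_eq_iff forall_2 matrix_vector_mult_def sum_2)
        then show ?thesis using u(1) st sub by (simp add: vec.subspace_diff)
      qed
      have unscale: "v \<in> U" if "k *s v \<in> U" "k \<noteq> 0" for k v
        using vec.subspace_scale[OF sub that(1), of "inverse k"] that(2) by simp
      have e12: "?e2 \<in> U" if "?e1 \<in> U"
      proof (rule unscale[of c])
        have "c *s ?e2 = ?A2 *v ?e1 - a *s ?e1"
          by (simp add: vec_eq_iff forall_2 matrix_vector_mult_def sum_2)
        then show "c *s ?e2 \<in> U" using that st sub by (simp add: vec.subspace_diff vec.subspace_scale)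
      qed fact
      have e21: "?e1 \<in> U" if "?e2 \<in> U"
      proof (rule unscale[of b])
        have "b *s ?e1 = ?A2 *v ?e2 + a *s ?e2"
          by (simp add: vec_eq_iff forall_2 matrix_vector_mult_def sum_2)
        then show "b *s ?e1 \<in> U" using that st sub by (simp add: vec.subspace_add vec.subspace_scale)
      qed fact
      have "u $ 1 \<noteq> 0 \<or> u $ 2 \<noteq> 0"
        using u(2) by (simp add: vec_eq_iff forall_2)
      then have e: "?e1 \<in> U" "?e2 \<in> U"
        using unscale[OF u1] unscale[OF u2] e12 e21 by auto
      have "v \<in> U" for v
      proof -
        have "v = (v $ 1) *s ?e1 + (v $ 2) *s ?e2"
          by (simp add: vec_eq_iff forall_2)
        then show ?thesis
          using e sub by (metis vec.subspace_add vec.subspace_scale)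
      qed
      then show ?thesis by blast
    qed simp
    moreover have "(UNIV :: (complex ^ 2) set) \<noteq> {0}"
      using axis_eq_0_iff[of 1 "1 :: complex"] by (metis UNIV_I singletonD zero_neq_one)
    ultimately have "irreducible_module G act"
      using act(1) by (auto simp: irreducible_module_def irreducible_submodule_def stable_subspace_def)
    moreover have "map (character_of act) [\<one>, s1, s2, s1 \<otimes> s2, (s1 \<otimes> s2) [^] (2::nat), (s1 \<otimes> s2) [^] (3::nat)]
        = char_values \<phi>"
    proof -
      have 12: "act (s1 \<otimes> s2) = (*v) (?A1 ** ?A2)"
        using act generators_closed by (simp add: linear_action_def comp_def matrix_vector_mul_assoc)
      have pow: "act ((s1 \<otimes> s2) [^] (2::nat)) = (*v) (?A1 ** ?A2 ** (?A1 ** ?A2))"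
        "act ((s1 \<otimes> s2) [^] (3::nat)) = (*v) (?A1 ** ?A2 ** (?A1 ** ?A2) ** (?A1 ** ?A2))"
        using act(1) generators_closed 12
        by (simp_all add: linear_action_def comp_def matrix_vector_mul_assoc numeral_2_eq_2 numeral_3_eq_3)
      have "trace (matrix (act \<one>)) = 2"
        using act(1) by (simp add: linear_action_def matrix_id_mat_1 trace_def mat_def)
      moreover have "trace (?A1 ** ?A2 ** (?A1 ** ?A2)) = -1"
        unfolding A12_2 by (simp add: trace_def sum_2)
      moreover have "trace (?A1 ** ?A2 ** (?A1 ** ?A2) ** (?A1 ** ?A2)) = - 4 * a"
        unfolding A12_3 by (simp add: trace_def sum_2)
      moreover have "trace (?A1 ** ?A2) = 2 * a"
        unfolding A12 by (simp add: trace_def sum_2)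
      moreover have "trace ?A1 = 0" "trace ?A2 = 0"
        by (simp_all add: trace_def sum_2)
      ultimately show ?thesis
        by (simp add: chars character_of_def 12 pow act(2,3))
    qed
    ultimately show ?thesis
      unfolding irreducible_with_label_def by blast
  qed
  fix act :: "'a \<Rightarrow> complex ^ 2 \<Rightarrow> complex ^ 2"
  assume "irreducible_with_label G s1 s2 \<phi> act"
  then have act: "irreducible_module G act"
    and tr: "trace (matrix (act s1)) = 0" "trace (matrix (act s2)) = 0"
      "trace (matrix (act (s1 \<otimes> s2))) = 2 * a"
    by (auto simp: irreducible_with_label_def chars character_of_def)
  have lin: "Vector_Spaces.linear (*s) (*s) (act g)" if "g \<in> carrier G" for g
    using that act by (auto simp: irreducible_module_def linear_action_def)
  have mult: "act (g \<otimes> h) = act g \<circ> act h" if "g \<in> carrier G" "h \<in> carrier G" for g h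
    using that act by (auto simp: irreducible_module_def linear_action_def)
  have one: "act \<one> = id"
    using act by (auto simp: irreducible_module_def linear_action_def)
  have lin1: "Vector_Spaces.linear (*s) (*s) (act s1)" and lin2: "Vector_Spaces.linear (*s) (*s) (act s2)"
    using lin generators_closed by auto
  have inv1: "act s1 (act s1 v) = v" and inv2: "act s2 (act s2 v) = v" for v
    using mult[of s1 s1] mult[of s2 s2] generators_closed involutions one
    by (simp_all add: fun_eq_iff)
  \<comment> \<open>Since \<open>s1\<close> acts as an involution,
    \<open>act s1 v + \<epsilon> *s v\<close> always satisfies the eigenvector equation for
    \<open>\<epsilon>\<close>. Were it always zero, \<open>s1\<close> would act as the scalar
    \<open>- \<epsilon>\<close>, with nonzero trace.\<close>
  have "\<exists>v. v \<noteq> 0 \<and> act s1 v = \<epsilon> *s v" if \<epsilon>: "\<epsilon>\<^sup>2 = 1" for \<epsilon>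
  proof (rule ccontr)
    assume *: "\<not> ?thesis"
    have "act s1 v = (- \<epsilon>) *s v" for v
    proof -
      have "act s1 (act s1 v + \<epsilon> *s v) = \<epsilon> *s (act s1 v + \<epsilon> *s v)"
        using \<epsilon> by (simp add: vec.linear_add[OF lin1] vec.linear_scale[OF lin1] inv1
            vec.scale_right_distrib power2_eq_square)
      then have "act s1 v + \<epsilon> *s v = 0" using * by blast
      then show ?thesis by (simp add: eq_neg_iff_add_eq_0)
    qed
    then have "act s1 = (*v) (mat (- \<epsilon>))"
      by (simp add: fun_eq_iff vec_eq_iff forall_2 matrix_vector_mult_def sum_2 mat_def)
    then have "\<epsilon> = 0"
      using tr(1) by (simp add: trace_def sum_2 mat_def)
    then show False using \<epsilon> by simp
  qed
  from this[of 1] this[of "-1"] obtain v w where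
    v: "v \<noteq> 0" "act s1 v = v" and w: "w \<noteq> 0" "act s1 w = - w"
    by auto
  \<comment> \<open>The second vector stays a parameter because \<open>w\<close> is later replaced
    by a multiple of itself.\<close>
  define fam :: "complex ^ 2 \<Rightarrow> 2 \<Rightarrow> complex ^ 2" where "fam = (\<lambda>w i. if i = 1 then v else w)"
  have fam: "fam w 1 = v" "fam w 2 = w" for w by (auto simp: fam_def)
  have indep: "\<forall>k. (\<Sum>i\<in>UNIV. k i *s fam w i) = 0 \<longrightarrow> (\<forall>i. k i = 0)"
    if w: "w \<noteq> 0" "act s1 w = - w" for w
  proof (intro allI impI)
    fix k i assume 0: "(\<Sum>i\<in>UNIV. k i *s fam w i) = 0"
    have 1: "k 1 *s v + k 2 *s w = 0" using 0 by (simp add: sum_2 fam)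
    have "act s1 (k 1 *s v + k 2 *s w) = k 1 *s v - k 2 *s w"
      by (simp add: vec.linear_add[OF lin1] vec.linear_scale[OF lin1] v w)
    then have 2: "k 1 *s v - k 2 *s w = 0" by (simp add: 1 vec.linear_0[OF lin1])
    have "(2 * k 1) *s v = (k 1 *s v + k 2 *s w) + (k 1 *s v - k 2 *s w)"
      "(2 * k 2) *s w = (k 1 *s v + k 2 *s w) - (k 1 *s v - k 2 *s w)"
      by (simp_all add: vec_eq_iff algebra_simps)
    then have "(2 * k 1) *s v = 0" "(2 * k 2) *s w = 0"
      by (simp_all only: 1 2) simp_all
    then have "\<forall>i. k i = 0" using v w by (simp add: forall_2)
    then show "k i = 0" by blast
  qed
  have coords: "\<exists>p r. u = p *s v + r *s w" for u
  proof -
    have "range (fam w) = {v, w}"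
      by (simp add: UNIV_2 fam)
    then have "u \<in> vec.span {v, w}"
      using basis_family_span[OF indep[OF w]] by auto
    then obtain p where "u - p *s v \<in> vec.span {w}"
      by (auto simp: vec.span_breakdown_eq)
    then obtain r where "u - p *s v = r *s w"
      by (auto simp: vec.span_singleton)
    then have "u = p *s v + r *s w"
      by (simp add: algebra_simps)
    then show ?thesis by blast
  qed
  obtain p r where pr: "act s2 v = p *s v + r *s w"
    using coords by blast
  obtain q t where qt: "act s2 w = q *s v + t *s w"
    using coords by blast
  have tr_eq: "trace (matrix f) = \<alpha> + \<delta>"
    if "Vector_Spaces.linear (*s) (*s) f" "f v = \<alpha> *s v + \<gamma> *s w" "f w = \<beta> *s v + \<delta> *s w"
    for f \<alpha> \<beta> \<gamma> \<delta>
  proof -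
    let ?M = "vector [vector [\<alpha>, \<beta>], vector [\<gamma>, \<delta>]] :: complex ^ 2 ^ 2"
    have "\<forall>j. f (fam w j) = (\<Sum>i\<in>UNIV. ?M $ i $ j *s fam w i)"
      using that by (simp add: forall_2 sum_2 fam)
    then have "trace (matrix f) = trace ?M"
      using trace_eq_trace_wrt_basis_family[OF indep[OF w], of f ?M] that(1) by blast
    then show ?thesis by (simp add: trace_def sum_2)
  qed
  \<comment> \<open>The diagonal of \<open>s2\<close> comes from two traces: applying
    \<open>s1\<close> afterwards negates the \<open>w\<close> coordinate, so \<open>s2\<close> gives
    \<open>p + t\<close> and \<open>s1 \<otimes> s2\<close> gives \<open>p - t\<close>.\<close>
  have "p + t = 0"
    using tr_eq[OF lin2 pr qt] tr by simp
  moreover have "p - t = 2 * a"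
  proof -
    have "act (s1 \<otimes> s2) v = p *s v + (- r) *s w" "act (s1 \<otimes> s2) w = q *s v + (- t) *s w"
      using generators_closed v w
      by (simp_all add: mult pr qt vec.linear_add[OF lin1] vec.linear_scale[OF lin1])
    then show ?thesis
      using tr_eq[OF lin] generators_closed tr by (metis diff_conv_add_uminus m_closed)
  qed
  ultimately have pt: "p = a" "t = - a"
    by algebra+
  \<comment> \<open>Compares \<open>v\<close> with the image of \<open>v\<close> under the square of
    \<open>s2\<close>; the \<open>w\<close> coordinate carries the factor
    \<open>p + t = 0\<close>.\<close>
  have "(p * p + r * q - 1) *s v = 0"
  proof -
    have "v = act s2 (act s2 v)" by (simp add: inv2)
    also have "\<dots> = (p * p + r * q) *s v + (r * (p + t)) *s w"
      by (simp add: pr qt vec.linear_add[OF lin2] vec.linear_scale[OF lin2] vec_eq_iff algebra_simps)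
    finally show ?thesis
      by (simp add: pt algebra_simps)
  qed
  then have rq: "r * q = 3 / 4"
    using v aa by (simp add: pt)
  then have "q \<noteq> 0" by auto
  \<comment> \<open>The factor \<open>b / q\<close> turns the upper right entry \<open>q\<close>
    into \<open>b\<close>; the lower left entry then becomes \<open>c\<close>, because
    \<open>r * q = c * b\<close>.\<close>
  define w' where "w' = (b / q) *s w"
  have w': "w' \<noteq> 0" "act s1 w' = - w'"
    using w \<open>b \<noteq> 0\<close> \<open>q \<noteq> 0\<close> by (simp_all add: w'_def vec.linear_scale[OF lin1])
  note indep' = indep[OF w']
  have s2v: "act s2 v = a *s v + c *s w'"
  proof -
    have "r * q = c * b" by (simp only: rq cb)
    then have "r = c * b / q"
      using \<open>q \<noteq> 0\<close> by (simp add: nonzero_eq_divide_eq)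
    then show ?thesis by (simp add: pr pt w'_def)
  qed
  have s2w': "act s2 w' = b *s v + (- a) *s w'"
    using \<open>q \<noteq> 0\<close> by (simp add: w'_def vec.linear_scale[OF lin2] qt pt vec_eq_iff field_simps)
  have "\<forall>j. act s1 (fam w' j) = (\<Sum>i\<in>UNIV. ?A1 $ i $ j *s fam w' i)"
    using v w' by (simp add: forall_2 sum_2 fam)
  then have m1: "matrix_wrt (fam w') (act s1) = ?A1"
    using matrix_wrt_basis_family[OF indep'] by blast
  have "\<forall>j. act s2 (fam w' j) = (\<Sum>i\<in>UNIV. ?A2 $ i $ j *s fam w' i)"
    using s2v s2w' by (simp add: forall_2 sum_2 fam)
  then have m2: "matrix_wrt (fam w') (act s2) = ?A2"
    using matrix_wrt_basis_family[OF indep'] by blast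
  have eig: "adapted act [generate G {s1}, {\<one>}] {u}" if "u \<noteq> 0" "act s1 u = k *s u" for u k
  proof (rule adapted_eigenvector[OF that(1)])
    fix H g assume "H \<in> set [generate G {s1}, {\<one>}]" "g \<in> H"
    then have "g = \<one> \<or> g = s1" by (auto simp: generate_s1)
    then show "Vector_Spaces.linear (*s) (*s) (act g) \<and> (\<exists>c. act g u = c *s u)"
      using lin generators_closed that(2) by (auto simp: one intro: exI[of _ 1])
  qed
  have range: "range (fam w') = {v, w'}"
    by (simp add: UNIV_2 fam)
  have "v \<noteq> w'"
    using inj_eq[OF basis_family_inj[OF indep'], of 1 2] by (simp add: fam)
  \<comment> \<open>On restriction to the subgroup generated by \<open>s1\<close> the module splits
    into the two eigenlines, which stay irreducible for the trivial group. The top level of the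
    chain is the irreducibility of the module itself.\<close>
  then have "partition_on {v, w'} {{v}, {w'}}"
    by (auto simp: partition_on_def disjoint_def)
  moreover have "\<forall>C\<in>{{v}, {w'}}. adapted act [generate G {s1}, {\<one>}] C"
    using eig[of v 1] eig[of w' "-1"] v w' by simp
  ultimately have "adapted act (rev (WG2_chain G s1)) (range (fam w'))"
    using act basis_family_span[OF indep']
    by (auto simp: WG2_chain_def irreducible_module_def range)
  then have "seminormal_basis G (WG2_chain G s1) act (fam w')"
    using act WG2_chain_subgroup_chain basis_family_inj[OF indep'] basis_family_independent[OF indep']
      basis_family_span[OF indep']
    by (simp add: seminormal_basis_def)
  then show "\<exists>b. seminormal_basis G (WG2_chain G s1) act b \<and>
      matrix_wrt b (act s1) = ?A1 \<and> matrix_wrt b (act s2) = ?A2"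
    using m1 m2 by blast
qed

theorem theorem6p7:
  fixes G :: "('g, 'm) monoid_scheme" and s1 s2 :: 'g
  assumes "WG2 G s1 s2"
  shows
    "seminormal_form G s1 s2 phi_1_0
       (vector [vector [1]] :: complex ^ 1 ^ 1)
       (vector [vector [1]]) \<and>
     seminormal_form G s1 s2 phi_1_6
       (vector [vector [-1]] :: complex ^ 1 ^ 1)
       (vector [vector [-1]]) \<and>
     seminormal_form G s1 s2 phi_1_3p
       (vector [vector [1]] :: complex ^ 1 ^ 1)
       (vector [vector [-1]]) \<and>
     seminormal_form G s1 s2 phi_1_3pp
       (vector [vector [-1]] :: complex ^ 1 ^ 1)
       (vector [vector [1]]) \<and>
     seminormal_form G s1 s2 phi_2_1
       (vector [vector [1, 0], vector [0, -1]] :: complex ^ 2 ^ 2)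
       (vector [vector [1/2, 1/2], vector [3/2, -1/2]]) \<and>
     seminormal_form G s1 s2 phi_2_2
       (vector [vector [1, 0], vector [0, -1]] :: complex ^ 2 ^ 2)
       (vector [vector [-1/2, 3/2], vector [1/2, 1/2]])"
proof -
  interpret WG2 G s1 s2 by fact
  show ?thesis
    \<comment> \<open>The arguments are \<open>a\<close>, \<open>b\<close>, \<open>c\<close>: the
      first row and the lower left entry of the prescribed matrix of \<open>s2\<close>.\<close>
    using seminormal_form_dim_2[of phi_2_1 "1/2" "1/2" "3/2"]
      seminormal_form_dim_2[of phi_2_2 "-1/2" "3/2" "1/2"]
    by (auto intro: seminormal_form_dim_1 simp: power2_eq_square)
qed

end
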